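(* Let $X$ and $Y$ be Hausdorff topological spaces, $f:X\to Y$ continuous, and $\mathcal{M}$ an inner increasing multi-family on $X$. Then, as multi-sets on $Y$, $\lim(f\ast\mathcal{M})\ge\textbf{multi-}f(\lim\mathcal{M})$.
   Context: A multi-set on a set $Z$ is a function $Z\to\{0,1,\ldots,\infty\}$. A multi-family on $X$ is a function $\mathcal{M}$ from the power set of $X$ to $\{0,1,\ldots,\infty\}$; it is increasing if $S\subseteq S'$ implies $\mathcal{M}(S)\le\mathcal{M}(S')$, and an increasing multi-family is inner if for any finitely many pairwise disjoint subsets $S_1,\ldots,S_k$ one has $\mathcal{M}(S_1\cup\dots\cup S_k)\ge\sum_{i=1}^k\mathcal{M}(S_i)$. The push of $\mathcal{M}$ by $f$ is the multi-family $(f\ast\mathcal{M})(S)=\mathcal{M}(f^{-1}(S))$ on $Y$. For an increasing multi-family $\mathcal{M}$ on a Hausdorff space $X$, its multi-set-limit is the multi-set $(\lim\mathcal{M})(x)=\min\{\mathcal{M}(U)\mid U\text{ open},\ x\in U\}$. For a multi-set $L$ on $X$, its multi-image is the multi-set on $Y$ given by $\textbf{multi-}f(L)(y)=\sum_{x\in f^{-1}(y)}L(x)$ (a sum of elements of $\{0,1,\ldots,\infty\}$, equal to $\infty$ if infinitely many terms are nonzero). Inequality of multi-sets is pointwise. *)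

theory Defs
  imports "HOL-Analysis.Analysis"
begin

text \<open>
  A space is a value \<open>X :: 'a topology\<close> with underlying set \<open>topspace X\<close>. Multi-sets and
  multi-families on \<open>X\<close> are total functions of which only the values at points, respectively
  subsets, of \<open>topspace X\<close> are meaningful. In particular, \<open>M\<close> is increasing on \<open>X\<close> iff
  \<open>increasing (Pow (topspace X)) M\<close>, with the library's notion of \<open>increasing\<close>.
\<close>

type_synonym 'a multi_set = "'a \<Rightarrow> enat"

type_synonym 'a multi_family = "'a set \<Rightarrow> enat"

definition inner_multi_family :: "'a topology \<Rightarrow> 'a multi_family \<Rightarrow> bool" where
  "inner_multi_family X M \<longleftrightarrow>
     (\<forall>(k::nat) S. (\<forall>i\<in>{1..k}. S i \<subseteq> topspace X) \<and> disjoint_family_on S {1..k}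
        \<longrightarrow> M (\<Union>i\<in>{1..k}. S i) \<ge> (\<Sum>i=1..k. M (S i)))"

definition multi_push :: "'a topology \<Rightarrow> ('a \<Rightarrow> 'b) \<Rightarrow> 'a multi_family \<Rightarrow> 'b multi_family" where
  "multi_push X f M S = M {x \<in> topspace X. f x \<in> S}"

definition multi_lim :: "'a topology \<Rightarrow> 'a multi_family \<Rightarrow> 'a multi_set" where
  "multi_lim X M x = (LEAST n. n \<in> {M U | U. openin X U \<and> x \<in> U})"

text \<open>
  Every family in \<open>enat\<close> is summable (\<open>nonneg_summable_on_complete\<close>), so \<open>infsum\<close> never takes
  its default value here: it is the supremum of the finite partial sums.
\<close>

definition multi_image :: "'a topology \<Rightarrow> ('a \<Rightarrow> 'b) \<Rightarrow> 'a multi_set \<Rightarrow> 'b multi_set" where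
  "multi_image X f L y = (\<Sum>\<^sub>\<infinity>x\<in>{x \<in> topspace X. f x = y}. L x)"

end

theory Submission
  imports Defs
begin

text \<open>
  The limit of the push at \<open>y\<close> is attained at some open \<open>V \<ni> y\<close>. Finitely many points of the
  fibre over \<open>y\<close> have pairwise disjoint open neighbourhoods inside the preimage of \<open>V\<close>, so
  innerness bounds every finite partial sum of the multi-image by the value on that preimage.
\<close>

lemma multi_lim_le:
  assumes "openin X U" "x \<in> U"
  shows "multi_lim X M x \<le> M U"
  unfolding multi_lim_def by (rule Least_le) (use assms in auto)

text \<open>Since \<open>enat\<close> is well-ordered, a nonempty set of values has a least member;
  \<open>topspace X\<close> is an open neighbourhood of \<open>x\<close> and makes the set
  nonempty.\<close>

lemma multi_lim_attained:
  assumes "x \<in> topspace X"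
  obtains U where "openin X U" "x \<in> U" "multi_lim X M x = M U"
proof -
  have "M (topspace X) \<in> {M U | U. openin X U \<and> x \<in> U}"
    using assms by auto
  then have "multi_lim X M x \<in> {M U | U. openin X U \<and> x \<in> U}"
    unfolding multi_lim_def by (rule LeastI)
  then show thesis
    using that by auto
qed

text \<open>Each point has to avoid only finitely many others, so a finite intersection of pairwise
  separating neighbourhoods is still open.\<close>

lemma Hausdorff_space_separate_finite:
  assumes "Hausdorff_space X" "finite F" "F \<subseteq> W" "openin X W"
  obtains U where "\<And>x. x \<in> F \<Longrightarrow> openin X (U x)" "\<And>x. x \<in> F \<Longrightarrow> x \<in> U x"
    "\<And>x. x \<in> F \<Longrightarrow> U x \<subseteq> W" "disjoint_family_on U F"
proof -
  have FX: "F \<subseteq> topspace X"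
    using assms openin_subset by blast
  have "\<forall>x\<in>F. \<forall>z\<in>F - {x}. \<exists>A B. openin X A \<and> openin X B \<and> x \<in> A \<and> z \<in> B \<and> disjnt A B"
    using assms(1) FX unfolding Hausdorff_space_def by blast
  then obtain A B where AB: "\<And>x z. x \<in> F \<Longrightarrow> z \<in> F - {x} \<Longrightarrow>
      openin X (A x z) \<and> openin X (B x z) \<and> x \<in> A x z \<and> z \<in> B x z \<and> disjnt (A x z) (B x z)"
    by metis
  \<comment> \<open>The separations of \<open>(x, z)\<close> and \<open>(z, x)\<close> are chosen
    independently. Taking both neighbourhoods of \<open>x\<close> puts \<open>U x\<close> inside
    \<open>A x z\<close> and \<open>U z\<close> inside \<open>B x z\<close>, which are
    disjoint.\<close>
  define U where "U x = (\<Inter>z\<in>F - {x}. A x z \<inter> B z x) \<inter> W" for x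
  show thesis
  proof (rule that)
    show "openin X (U x)" if "x \<in> F" for x
    \<comment> \<open>An empty intersection is \<open>UNIV\<close>, which need not be open in
      \<open>X\<close>; here only \<open>W\<close> remains.\<close>
    proof (cases "F - {x} = {}")
      case True
      then show ?thesis
        unfolding U_def True using assms(4) by simp
    next
      case False
      have "openin X (\<Inter>z\<in>F - {x}. A x z \<inter> B z x)"
        using assms(2) False AB that by (intro openin_INT2 openin_Int) auto
      then show ?thesis
        unfolding U_def using assms(4) by (rule openin_Int)
    qed
    show "x \<in> U x" if "x \<in> F" for x
      unfolding U_def using AB that assms(3) by blast
    show "U x \<subseteq> W" for x
      unfolding U_def by blast
    show "disjoint_family_on U F"
      unfolding disjoint_family_on_def
    proof (intro ballI impI)
      fix x z assume xz: "x \<in> F" "z \<in> F" "x \<noteq> z"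
      then have "U x \<subseteq> A x z" "U z \<subseteq> B x z"
        unfolding U_def by auto
      then show "U x \<inter> U z = {}"
        using AB[of x z] xz unfolding disjnt_def by blast
    qed
  qed
qed

text \<open>Innerness speaks of families indexed by \<open>{1..k}\<close>; a bijection from
  \<open>{1..card F}\<close> carries it over to families indexed by points.\<close>

lemma inner_multi_family_sum_le:
  assumes "inner_multi_family X M" "finite F"
    and "\<And>x. x \<in> F \<Longrightarrow> U x \<subseteq> topspace X" "disjoint_family_on U F"
  shows "(\<Sum>x\<in>F. M (U x)) \<le> M (\<Union>x\<in>F. U x)"
proof -
  obtain h where h: "bij_betw h {1..card F} F"
    using assms(2) finite_same_card_bij[of "{1..card F}" F] by auto
  then have img: "h ` {1..card F} = F" and inj: "inj_on h {1..card F}"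
    by (auto simp: bij_betw_def)
  have sub: "\<forall>i\<in>{1..card F}. U (h i) \<subseteq> topspace X"
    using assms(3) img by blast
  have disj: "disjoint_family_on (\<lambda>i. U (h i)) {1..card F}"
    unfolding disjoint_family_on_def
  proof (intro ballI impI)
    fix i j assume ij: "i \<in> {1..card F}" "j \<in> {1..card F}" "i \<noteq> j"
    then have "h i \<in> F" "h j \<in> F" "h i \<noteq> h j"
      using img inj by (auto dest: inj_onD)
    then show "U (h i) \<inter> U (h j) = {}"
      using assms(4) unfolding disjoint_family_on_def by blast
  qed
  have "(\<Sum>i=1..card F. M (U (h i))) \<le> M (\<Union>i\<in>{1..card F}. U (h i))"
    using assms(1) sub disj unfolding inner_multi_family_def
    by (elim allE[of _ "card F"] allE[of _ "\<lambda>i. U (h i)"] impE) (intro conjI)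
  moreover have "(\<Union>i\<in>{1..card F}. U (h i)) = (\<Union>x\<in>F. U x)"
    by (simp only: img flip: image_image[of U h])
  moreover have "(\<Sum>i=1..card F. M (U (h i))) = (\<Sum>x\<in>F. M (U x))"
    by (rule sum.reindex_bij_betw[OF h])
  ultimately show ?thesis
    by (simp only:)
qed

text \<open>Separating neighbourhoods inside \<open>W\<close> bound the limits one by one, innerness
  adds these bounds, and monotonicity passes from the union to \<open>W\<close>.\<close>

lemma sum_multi_lim_le:
  assumes "Hausdorff_space X" "increasing (Pow (topspace X)) M" "inner_multi_family X M"
    and "finite F" "F \<subseteq> W" "openin X W"
  shows "(\<Sum>x\<in>F. multi_lim X M x) \<le> M W"
proof -
  obtain U where U: "\<And>x. x \<in> F \<Longrightarrow> openin X (U x)" "\<And>x. x \<in> F \<Longrightarrow> x \<in> U x"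
    "\<And>x. x \<in> F \<Longrightarrow> U x \<subseteq> W" "disjoint_family_on U F"
    using Hausdorff_space_separate_finite[OF assms(1,4-6)] by blast
  have WX: "W \<subseteq> topspace X"
    using assms(6) by (rule openin_subset)
  have "(\<Sum>x\<in>F. multi_lim X M x) \<le> (\<Sum>x\<in>F. M (U x))"
    using U by (intro sum_mono multi_lim_le)
  also have "\<dots> \<le> M (\<Union>x\<in>F. U x)"
    using U WX by (intro inner_multi_family_sum_le[OF assms(3,4)]) blast+
  also have "\<dots> \<le> M W"
    using U(3) WX by (intro increasingD[OF assms(2)]) blast+
  finally show ?thesis .
qed

theorem mainTheorem3:
  fixes X :: "'a topology" and Y :: "'b topology"
    and f :: "'a \<Rightarrow> 'b" and M :: "'a multi_family"
  assumes "Hausdorff_space X" and "Hausdorff_space Y"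
    and "continuous_map X Y f"
    and "increasing (Pow (topspace X)) M"
    and "inner_multi_family X M"
  shows "\<forall>y\<in>topspace Y. multi_lim Y (multi_push X f M) y \<ge> multi_image X f (multi_lim X M) y"
proof
  fix y assume "y \<in> topspace Y"
  then obtain V where V: "openin Y V" "y \<in> V"
    and eq: "multi_lim Y (multi_push X f M) y = multi_push X f M V"
    by (rule multi_lim_attained)
  have W: "openin X {x \<in> topspace X. f x \<in> V}"
    using assms(3) V(1) by (rule openin_continuous_map_preimage)
  have "multi_image X f (multi_lim X M) y \<le> M {x \<in> topspace X. f x \<in> V}"
    unfolding multi_image_def
  \<comment> \<open>The fibre may be infinite; a common bound on its finite partial sums
    suffices.\<close>
  proof (rule infsum_le_finite_sums)
    show "multi_lim X M summable_on {x \<in> topspace X. f x = y}"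
      by (rule nonneg_summable_on_complete) simp
    show "sum (multi_lim X M) F \<le> M {x \<in> topspace X. f x \<in> V}"
      if "finite F" "F \<subseteq> {x \<in> topspace X. f x = y}" for F
      \<comment> \<open>Since \<open>y\<close> lies in \<open>V\<close>, the whole fibre over
        \<open>y\<close> lies in the open preimage of \<open>V\<close>.\<close>
      using that V(2) by (intro sum_multi_lim_le[OF assms(1,4,5) _ _ W]) auto
  qed
  then show "multi_image X f (multi_lim X M) y \<le> multi_lim Y (multi_push X f M) y"
    by (simp add: eq multi_push_def)
qed

end
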